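(* Let $m\le n$ be natural numbers with $\mathfrak{d}:=m+2(n-m)\ge 2$. Then the three binary relational structures $\mathbb{U}(n,m)$, $\mathbb{T}(n,m)$ and $\mathbb{D}(n,m)$ are pairwise equimorphic, i.e. each of them embeds as an induced substructure into each of the others.
   Context: Two relational structures $\mathrm{A},\mathrm{B}$ are equimorphic if there is an isomorphism of $\mathrm{A}$ onto an induced substructure of $\mathrm{B}$ and an isomorphism of $\mathrm{B}$ onto an induced substructure of $\mathrm{A}$. Simple binary structures: for $m\le n$, a structure in the signature of $n$ binary relations $E_0,\dots,E_{n-1}$ with symmetry number $m$ is one in which every $E_i$ is irreflexive; $E_i$ is symmetric for $i<m$; $E_i(x,y)$ implies $\neg E_i(y,x)$ for $m\le i<n$; for distinct $x,y$ and $i\ne j$, $E_i(x,y)$ implies $\neg E_j(x,y)$ and $\neg E_j(y,x)$; and for all distinct $x,y$ there is some $i$ with $E_i(x,y)$. Let $\mathscr{A}(n,m)$ be the class of all finite such structures; it is an amalgamation class and $\mathbb{U}(n,m)$ denotes its Fraïssé limit (the countable ultrahomogeneous structure with age $\mathscr{A}(n,m)$). Trees: let $\mathfrak{T_d}$ be the set of all finite sequences with entries in $\{0,\dots,\mathfrak{d}-1\}$, ordered by end-extension $\subseteq$; $|x|$ is the length of $x$, $x(i)$ its $i$-th entry, and $x\wedge y$ the longest common initial segment of $x$ and $y$. For $\subseteq$-incomparable $x,y$ write $x\prec y$ if $x(|x\wedge y|)<y(|x\wedge y|)$. The structure $\mathbb{T}(n,m)$ has universe $\mathfrak{T_d}$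 and relations $E_0,\dots,E_{n-1}$ defined as follows for distinct $x,y$ (and no other instances hold): (1) if $|x|<|y|$, let $p=y(|x|)$; if $p<m$ then $E_p(x,y)$ and $E_p(y,x)$; if $p\ge m$ and $p-m$ is even then $E_{m+(p-m)/2}(x,y)$; if $p\ge m$ and $p-m$ is odd then $E_{m+(p-m-1)/2}(y,x)$. (2) If $|x|=|y|$ and $x\prec y$: if $m=0$ then $E_0(x,y)$; if $m>0$ then $E_0(x,y)$ and $E_0(y,x)$. A set $S\subseteq\mathfrak{T_d}$ is strongly diagonal if: it is an antichain under $\subseteq$; its closure $\{x\wedge y: x,y\in S\}$ is transversal (no two distinct elements have the same length); every element of the closure has at most two immediate successors within the closure; and for all $x,y,z\in S$ with $x\ne y$: (i) if $|x\wedge y|<|z|$ and $x\wedge y\not\subseteq z$ then $z(|x\wedge y|)=0$; (ii) $x(|x\wedge y|)\in\{0,1\}$. A strong diagonalization of $\mathfrak{T_d}$ is an injection $f:\mathfrak{T_d}\to\mathfrak{T_d}$ whose image is strongly diagonal and such that for all $x,y,z,u\in\mathfrak{T_d}$: $|x\wedge y|<|z\wedge u|$ implies $|f(x)\wedge f(y)|<|f(z)\wedge f(u)|$; if $|z|>|x|$ then $z(|x|)=f(z)(|f(x)|)$; and $x\prec y$ implies $f(x)\prec f(y)$. Such maps exist; fix one, $\Delta_{\mathfrak{d}}$, and let $\mathfrak{D_d}$ be its image. Then $\mathbb{D}(n,m)$ is the substructure of $\mathbb{T}(n,m)$ induced on $\mathfrak{D_d}$.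
   Formalization: In the definition of simple binary structures, the last clause is read as: for distinct x,y some E_i(x,y) or E_i(y,x) holds; read literally for ordered pairs it would exclude all asymmetric relations and make the claim false when m<n. *)

theory Defs
  imports "HOL-Library.Sublist" "HOL-Library.Countable_Set" "HOL-Library.FuncSet"
begin

section \<open>Binary relational structures\<close>

text \<open>
  The signature is not part of the record: only the relations with index below \<open>n\<close>,
  restricted to the universe, are meaningful, and every notion below depends on the relations
  only through these values.
\<close>

record 'a binstruct =
  univ :: "'a set"
  rel :: "nat \<Rightarrow> 'a \<Rightarrow> 'a \<Rightarrow> bool"

definition induced :: "'a binstruct \<Rightarrow> 'a set \<Rightarrow> 'a binstruct" where
  "induced A S = \<lparr>univ = S, rel = rel A\<rparr>"

definition is_iso :: "nat \<Rightarrow> ('a \<Rightarrow> 'b) \<Rightarrow> 'a binstruct \<Rightarrow> 'b binstruct \<Rightarrow> bool" where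
  "is_iso n f A B \<longleftrightarrow>
     bij_betw f (univ A) (univ B) \<and>
     (\<forall>i<n. \<forall>x\<in>univ A. \<forall>y\<in>univ A. rel A i x y \<longleftrightarrow> rel B i (f x) (f y))"

definition embeds :: "nat \<Rightarrow> 'a binstruct \<Rightarrow> 'b binstruct \<Rightarrow> bool" where
  "embeds n A B \<longleftrightarrow> (\<exists>S f. S \<subseteq> univ B \<and> is_iso n f A (induced B S))"

definition equimorphic :: "nat \<Rightarrow> 'a binstruct \<Rightarrow> 'b binstruct \<Rightarrow> bool" where
  "equimorphic n A B \<longleftrightarrow> embeds n A B \<and> embeds n B A"

section \<open>Simple binary structures and their limit\<close>

text \<open>
  In the last clause the pair is unordered: it must be related in at least one direction.
  Asking for \<open>E\<^sub>i(x,y)\<close> for both orders of the pair would, together with the preceding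
  clause, exclude every instance of an asymmetric relation.
\<close>

definition simple_binary :: "nat \<Rightarrow> nat \<Rightarrow> 'a binstruct \<Rightarrow> bool" where
  "simple_binary n m A \<longleftrightarrow>
     (\<forall>i<n. \<forall>x\<in>univ A. \<not> rel A i x x) \<and>
     (\<forall>i<m. \<forall>x\<in>univ A. \<forall>y\<in>univ A. rel A i x y \<longrightarrow> rel A i y x) \<and>
     (\<forall>i. m \<le> i \<and> i < n \<longrightarrow>
        (\<forall>x\<in>univ A. \<forall>y\<in>univ A. rel A i x y \<longrightarrow> \<not> rel A i y x)) \<and>
     (\<forall>i<n. \<forall>j<n. i \<noteq> j \<longrightarrow>
        (\<forall>x\<in>univ A. \<forall>y\<in>univ A. x \<noteq> y \<and> rel A i x y \<longrightarrow>
           \<not> rel A j x y \<and> \<not> rel A j y x)) \<and>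
     (\<forall>x\<in>univ A. \<forall>y\<in>univ A. x \<noteq> y \<longrightarrow> (\<exists>i<n. rel A i x y \<or> rel A i y x))"

text \<open>
  Classes of finite structures are represented by their members with universe a finite set of
  natural numbers; every finite structure is isomorphic to such a one.
\<close>

definition finite_simple :: "nat \<Rightarrow> nat \<Rightarrow> nat binstruct set" where
  "finite_simple n m = {B. finite (univ B) \<and> simple_binary n m B}"

definition age :: "nat \<Rightarrow> 'a binstruct \<Rightarrow> nat binstruct set" where
  "age n A = {B. finite (univ B) \<and> embeds n B A}"

definition ultrahomogeneous :: "nat \<Rightarrow> 'a binstruct \<Rightarrow> bool" where
  "ultrahomogeneous n A \<longleftrightarrow>
     (\<forall>S S' f. S \<subseteq> univ A \<and> S' \<subseteq> univ A \<and> finite S \<and> finite S' \<and>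
        is_iso n f (induced A S) (induced A S') \<longrightarrow>
        (\<exists>g. is_iso n g A A \<and> (\<forall>x\<in>S. g x = f x)))"

definition is_fraisse_limit :: "nat \<Rightarrow> nat binstruct set \<Rightarrow> 'a binstruct \<Rightarrow> bool" where
  "is_fraisse_limit n K U \<longleftrightarrow> countable (univ U) \<and> ultrahomogeneous n U \<and> age n U = K"

section \<open>Trees of finite sequences\<close>

text \<open>
  The tree of all finite sequences with entries below \<open>d\<close> is \<open>lists {..<d}\<close>, ordered by
  \<^const>\<open>prefix\<close>; incomparability is \<^const>\<open>parallel\<close>.
\<close>

abbreviation meet :: "nat list \<Rightarrow> nat list \<Rightarrow> nat list" where
  "meet \<equiv> longest_common_prefix"

definition seq_prec :: "nat list \<Rightarrow> nat list \<Rightarrow> bool" (infix "\<lhd>" 50) where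
  "x \<lhd> y \<longleftrightarrow> x \<parallel> y \<and> x ! length (meet x y) < y ! length (meet x y)"

inductive tree_rel :: "nat \<Rightarrow> nat \<Rightarrow> nat list \<Rightarrow> nat list \<Rightarrow> bool" for m :: nat where
  sym1: "length x < length y \<Longrightarrow> p = y ! length x \<Longrightarrow> p < m \<Longrightarrow> tree_rel m p x y"
| sym2: "length x < length y \<Longrightarrow> p = y ! length x \<Longrightarrow> p < m \<Longrightarrow> tree_rel m p y x"
| even: "length x < length y \<Longrightarrow> p = y ! length x \<Longrightarrow> m \<le> p \<Longrightarrow> even (p - m) \<Longrightarrow>
           tree_rel m (m + (p - m) div 2) x y"
| odd:  "length x < length y \<Longrightarrow> p = y ! length x \<Longrightarrow> m \<le> p \<Longrightarrow> odd (p - m) \<Longrightarrow>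
           tree_rel m (m + (p - m - 1) div 2) y x"
| level1: "length x = length y \<Longrightarrow> x \<lhd> y \<Longrightarrow> tree_rel m 0 x y"
| level2: "length x = length y \<Longrightarrow> x \<lhd> y \<Longrightarrow> 0 < m \<Longrightarrow> tree_rel m 0 y x"

definition branching :: "nat \<Rightarrow> nat \<Rightarrow> nat" where
  "branching n m = m + 2 * (n - m)"

definition T_struct :: "nat \<Rightarrow> nat \<Rightarrow> nat list binstruct" where
  "T_struct n m = \<lparr>univ = lists {..<branching n m}, rel = tree_rel m\<rparr>"

section \<open>Strong diagonalization\<close>

definition meet_closure :: "nat list set \<Rightarrow> nat list set" where
  "meet_closure S = {meet x y |x y. x \<in> S \<and> y \<in> S}"

definition transversal :: "nat list set \<Rightarrow> bool" where
  "transversal S \<longleftrightarrow> (\<forall>x\<in>S. \<forall>y\<in>S. x \<noteq> y \<longrightarrow> length x \<noteq> length y)"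

definition immediate_succs :: "nat list set \<Rightarrow> nat list \<Rightarrow> nat list set" where
  "immediate_succs S x =
     {y \<in> S. strict_prefix x y \<and> \<not> (\<exists>z\<in>S. strict_prefix x z \<and> strict_prefix z y)}"

definition strongly_diagonal :: "nat list set \<Rightarrow> bool" where
  "strongly_diagonal S \<longleftrightarrow>
     (\<forall>x\<in>S. \<forall>y\<in>S. x \<noteq> y \<longrightarrow> x \<parallel> y) \<and>
     transversal (meet_closure S) \<and>
     (\<forall>x\<in>meet_closure S. finite (immediate_succs (meet_closure S) x) \<and>
        card (immediate_succs (meet_closure S) x) \<le> 2) \<and>
     (\<forall>x\<in>S. \<forall>y\<in>S. \<forall>z\<in>S. x \<noteq> y \<longrightarrow>
        (length (meet x y) < length z \<and> \<not> prefix (meet x y) z \<longrightarrow>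
           z ! length (meet x y) = 0) \<and>
        x ! length (meet x y) \<in> {0, 1})"

definition strong_diagonalization :: "nat \<Rightarrow> (nat list \<Rightarrow> nat list) \<Rightarrow> bool" where
  "strong_diagonalization d f \<longleftrightarrow>
     f \<in> lists {..<d} \<rightarrow> lists {..<d} \<and>
     inj_on f (lists {..<d}) \<and>
     strongly_diagonal (f ` lists {..<d}) \<and>
     (\<forall>x\<in>lists {..<d}. \<forall>y\<in>lists {..<d}. \<forall>z\<in>lists {..<d}. \<forall>u\<in>lists {..<d}.
        (length (meet x y) < length (meet z u) \<longrightarrow>
           length (meet (f x) (f y)) < length (meet (f z) (f u))) \<and>
        (length x < length z \<longrightarrow> z ! length x = f z ! length (f x)) \<and>
        (x \<lhd> y \<longrightarrow> f x \<lhd> f y))"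

definition D_struct :: "nat \<Rightarrow> nat \<Rightarrow> (nat list \<Rightarrow> nat list) \<Rightarrow> nat list binstruct" where
  "D_struct n m \<Delta> = induced (T_struct n m) (\<Delta> ` lists {..<branching n m})"

end

theory Submission
  imports Defs
begin

text \<open>
  \<open>\<bbbD>\<close> is a substructure of \<open>\<bbbT>\<close>, and \<open>\<bbbT>\<close> embeds into \<open>\<bbbU>\<close> because it is countable and
  simple and \<open>\<bbbU>\<close>, having every finite simple structure in its age, is universal for such
  structures by one-point extensions. To embed \<open>\<bbbU>\<close> into \<open>\<bbbD>\<close>, enumerate \<open>\<bbbU>\<close> and send the \<open>k\<close>-th
  element to a sequence of length \<open>k\<close> whose \<open>j\<close>-th entry codes the relation to the \<open>j\<close>-th element.
  The images have pairwise distinct lengths, and on such sets \<open>\<Delta>\<close> preserves the relations of \<open>\<bbbT>\<close>;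
  it need not do so for distinct sequences of equal length.
\<close>

section \<open>Embeddings\<close>

text \<open>\<open>embeds\<close> quantifies over the image as well as the map. Fixing only the map
  makes composition and restriction direct.\<close>

definition is_embedding :: "nat \<Rightarrow> ('a \<Rightarrow> 'b) \<Rightarrow> 'a binstruct \<Rightarrow> 'b binstruct \<Rightarrow> bool" where
  "is_embedding n f A B \<longleftrightarrow>
     f ` univ A \<subseteq> univ B \<and> inj_on f (univ A) \<and>
     (\<forall>i<n. \<forall>x\<in>univ A. \<forall>y\<in>univ A. rel A i x y \<longleftrightarrow> rel B i (f x) (f y))"

lemma induced_simps [simp]: "univ (induced A S) = S" "rel (induced A S) = rel A"
  by (simp_all add: induced_def)

lemma embeds_iff_embedding: "embeds n A B \<longleftrightarrow> (\<exists>f. is_embedding n f A B)"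
proof
  assume "embeds n A B"
  then show "\<exists>f. is_embedding n f A B"
    unfolding embeds_def is_iso_def is_embedding_def bij_betw_def by auto
next
  assume "\<exists>f. is_embedding n f A B"
  then obtain f where "is_embedding n f A B" ..
  then have "f ` univ A \<subseteq> univ B \<and> is_iso n f A (induced B (f ` univ A))"
    unfolding is_iso_def is_embedding_def bij_betw_def by auto
  then show "embeds n A B"
    unfolding embeds_def by blast
qed

lemma is_iso_imp_embedding: "is_iso n f A B \<Longrightarrow> is_embedding n f A B"
  by (auto simp: is_iso_def is_embedding_def bij_betw_def)

lemma is_embedding_comp:
  assumes "is_embedding n f A B" "is_embedding n g B C"
  shows "is_embedding n (g \<circ> f) A C"
proof -
  have "inj_on g (f ` univ A)"
    using assms by (auto simp: is_embedding_def intro: inj_on_subset)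
  then have "inj_on (g \<circ> f) (univ A)"
    using assms(1) by (simp add: is_embedding_def comp_inj_on)
  then show ?thesis
    using assms by (auto simp: is_embedding_def image_subset_iff)
qed

lemma embeds_trans: "embeds n A B \<Longrightarrow> embeds n B C \<Longrightarrow> embeds n A C"
  unfolding embeds_iff_embedding by (blast intro: is_embedding_comp)

lemma is_embedding_induced:
  "is_embedding n f A B \<Longrightarrow> S \<subseteq> univ A \<Longrightarrow> is_embedding n f (induced A S) B"
  by (auto simp: is_embedding_def subset_iff image_subset_iff intro: inj_on_subset)

lemma is_iso_inv_into:
  assumes "is_iso n f A B"
  shows "is_iso n (inv_into (univ A) f) B A"
proof -
  have "bij_betw f (univ A) (univ B)"
    using assms by (simp add: is_iso_def)
  then have "univ B = f ` univ A" "inj_on f (univ A)"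
    by (auto simp: bij_betw_def)
  then show ?thesis
    using assms by (auto simp: is_iso_def bij_betw_inv_into)
qed

text \<open>Members of an \<open>age\<close> live on sets of natural numbers, so a structure has to
  be transported along an injective numbering before it can be compared with an age.\<close>

lemma nat_copy:
  fixes A :: "'a binstruct"
  assumes "countable (univ A)"
  obtains B :: "nat binstruct" and e where "is_iso n e A B"
proof -
  define e where "e = to_nat_on (univ A)"
  define B where
    "B = \<lparr>univ = e ` univ A,
          rel = \<lambda>i x y. rel A i (inv_into (univ A) e x) (inv_into (univ A) e y)\<rparr>"
  have "inj_on e (univ A)"
    unfolding e_def using assms by (rule inj_on_to_nat_on)
  then have "is_iso n e A B"
    by (simp add: is_iso_def B_def inj_on_imp_bij_betw)
  then show thesis ..
qed

section \<open>Simple structures\<close>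

text \<open>Every clause of \<open>simple_binary\<close> concerns at most two elements. Collecting
  the clauses for one ordered pair lets simplicity be checked and transferred pair by pair.\<close>

definition simple_pair :: "nat \<Rightarrow> nat \<Rightarrow> (nat \<Rightarrow> 'a \<Rightarrow> 'a \<Rightarrow> bool) \<Rightarrow> 'a \<Rightarrow> 'a \<Rightarrow> bool" where
  "simple_pair n m R x y \<longleftrightarrow>
     (\<forall>i<n. \<not> R i x x) \<and>
     (\<forall>i<m. R i x y \<longrightarrow> R i y x) \<and>
     (\<forall>i. m \<le> i \<longrightarrow> i < n \<longrightarrow> R i x y \<longrightarrow> \<not> R i y x) \<and>
     (x \<noteq> y \<longrightarrow>
        (\<forall>i<n. \<forall>j<n. i \<noteq> j \<longrightarrow> R i x y \<longrightarrow> \<not> R j x y \<and> \<not> R j y x) \<and>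
        (\<exists>i<n. R i x y \<or> R i y x))"

lemma simple_binary_iff_pairs:
  "simple_binary n m A \<longleftrightarrow> (\<forall>x\<in>univ A. \<forall>y\<in>univ A. simple_pair n m (rel A) x y)" (is "?L \<longleftrightarrow> ?R")
proof
  assume ?L
  then show ?R
    unfolding simple_binary_def simple_pair_def by (intro ballI conjI impI; blast)
next
  assume R: ?R
  show ?L
    unfolding simple_binary_def
    using R[unfolded simple_pair_def] by (intro conjI allI ballI impI; blast)
qed

text \<open>The bound \<open>m \<le> n\<close> brings the symmetry clause, where
  \<open>i < m\<close>, into the range \<open>i < n\<close> on which the two families agree.\<close>

lemma simple_pair_cong:
  assumes "m \<le> n"
    and "x = y \<longleftrightarrow> x' = y'"
    and "\<And>i. i < n \<Longrightarrow> R i x x \<longleftrightarrow> R' i x' x'"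
    and "\<And>i. i < n \<Longrightarrow> R i x y \<longleftrightarrow> R' i x' y'"
    and "\<And>i. i < n \<Longrightarrow> R i y x \<longleftrightarrow> R' i y' x'"
  shows "simple_pair n m R x y \<longleftrightarrow> simple_pair n m R' x' y'"
  using assms by (simp add: simple_pair_def cong: conj_cong)

lemma simple_binary_embedding:
  assumes "m \<le> n" "is_embedding n f A B" "simple_binary n m B"
  shows "simple_binary n m A"
  unfolding simple_binary_iff_pairs
proof (intro ballI)
  fix x y assume xy: "x \<in> univ A" "y \<in> univ A"
  have "simple_pair n m (rel A) x y \<longleftrightarrow> simple_pair n m (rel B) (f x) (f y)"
    using assms(2) xy by (intro simple_pair_cong[OF assms(1)])
      (auto simp: is_embedding_def inj_on_eq_iff)
  moreover have "f x \<in> univ B" "f y \<in> univ B"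
    using assms(2) xy by (auto simp: is_embedding_def)
  ultimately show "simple_pair n m (rel A) x y"
    using assms(3) by (simp add: simple_binary_iff_pairs)
qed

lemma simple_binary_induced_pairs:
  assumes "\<And>x y. x \<in> univ A \<Longrightarrow> y \<in> univ A \<Longrightarrow> simple_binary n m (induced A {x, y})"
  shows "simple_binary n m A"
  using assms by (simp add: simple_binary_iff_pairs)

section \<open>Universality of the limit\<close>

text \<open>The age constrains only finite substructures, but simplicity is a condition on pairs:
  the substructure on \<open>{x, y}\<close> has a copy in the age and is therefore simple.\<close>

lemma fraisse_limit_simple:
  fixes U :: "'a binstruct"
  assumes "m \<le> n" "is_fraisse_limit n (finite_simple n m) U"
  shows "simple_binary n m U"
proof (rule simple_binary_induced_pairs)
  fix x y assume xy: "x \<in> univ U" "y \<in> univ U"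
  obtain B :: "nat binstruct" and e where e: "is_iso n e (induced U {x, y}) B"
    by (rule nat_copy[of "induced U {x, y}"]) simp_all
  have "bij_betw e {x, y} (univ B)"
    using e by (simp add: is_iso_def)
  then have fin: "finite (univ B)"
    using bij_betw_finite by blast
  have "is_embedding n (inv_into {x, y} e) B (induced U {x, y})"
    using is_iso_imp_embedding[OF is_iso_inv_into[OF e]] by simp
  then have "is_embedding n (inv_into {x, y} e) B U"
    using xy by (auto simp: is_embedding_def)
  then have "B \<in> age n U"
    using fin by (auto simp: age_def embeds_iff_embedding)
  then have "simple_binary n m B"
    using assms(2) by (auto simp: is_fraisse_limit_def finite_simple_def)
  then show "simple_binary n m (induced U {x, y})"
    using simple_binary_embedding[OF assms(1) is_iso_imp_embedding[OF e]] by blast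
qed

text \<open>The age provides some embedding of the larger structure, which may disagree with
  \<open>f\<close> on \<open>S\<close>; ultrahomogeneity supplies an automorphism of
  \<open>U\<close> that corrects it.\<close>

lemma fraisse_limit_extension:
  fixes A :: "'b binstruct" and U :: "'a binstruct"
  assumes mn: "m \<le> n" and U: "is_fraisse_limit n (finite_simple n m) U"
    and A: "simple_binary n m A" and S: "finite S" "insert a S \<subseteq> univ A"
    and f: "is_embedding n f (induced A S) U"
  obtains g where "is_embedding n g (induced A (insert a S)) U" "\<And>x. x \<in> S \<Longrightarrow> g x = f x"
proof -
  let ?S = "insert a S"
  obtain B :: "nat binstruct" and e where e: "is_iso n e (induced A ?S) B"
    by (rule nat_copy[of "induced A ?S"]) (use S in \<open>simp_all add: countable_finite\<close>)
  have bij: "bij_betw e ?S (univ B)"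
    using e by (simp add: is_iso_def)
  then have fin: "finite (univ B)"
    using S(1) bij_betw_finite by blast
  have AS: "simple_binary n m (induced A ?S)"
    by (rule simple_binary_embedding[OF mn _ A, of id])
      (use S in \<open>auto simp: is_embedding_def\<close>)
  have "simple_binary n m B"
    using simple_binary_embedding[OF mn is_iso_imp_embedding[OF is_iso_inv_into[OF e]] AS] .
  then have "B \<in> age n U"
    using U fin by (simp add: is_fraisse_limit_def finite_simple_def)
  then obtain h where h: "is_embedding n h B U"
    by (auto simp: age_def embeds_iff_embedding)
  define k where "k = h \<circ> e"
  have k: "is_embedding n k (induced A ?S) U"
    unfolding k_def using is_embedding_comp[OF is_iso_imp_embedding[OF e] h] .
  have kS: "is_embedding n k (induced A S) U"
    using is_embedding_induced[OF k, of S] subset_insertI[of S a] by (simp add: induced_def)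
  \<comment> \<open>\<open>p\<close> carries the copy of \<open>S\<close> placed by \<open>k\<close>
    onto the copy placed by \<open>f\<close>: a finite partial isomorphism of
    \<open>U\<close>.\<close>
  define p where "p = f \<circ> inv_into S k"
  have injk: "inj_on k S"
    using kS by (simp add: is_embedding_def)
  have pk: "p (k x) = f x" if "x \<in> S" for x
    using that injk by (simp add: p_def)
  have "bij_betw p (k ` S) (f ` S)"
    unfolding p_def
    using bij_betw_trans[OF bij_betw_inv_into[OF inj_on_imp_bij_betw[OF injk]], of f "f ` S"] f
    by (simp add: is_embedding_def inj_on_imp_bij_betw)
  moreover have "rel U i x y \<longleftrightarrow> rel U i (p x) (p y)"
    if "i < n" "x \<in> k ` S" "y \<in> k ` S" for i x y
    using that kS f by (auto simp: pk is_embedding_def)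
  ultimately have "is_iso n p (induced U (k ` S)) (induced U (f ` S))"
    by (simp add: is_iso_def)
  moreover have "k ` S \<subseteq> univ U" "f ` S \<subseteq> univ U"
    using kS f by (auto simp: is_embedding_def)
  moreover have "ultrahomogeneous n U"
    using U by (simp add: is_fraisse_limit_def)
  ultimately obtain g where g: "is_iso n g U U" "\<And>x. x \<in> k ` S \<Longrightarrow> g x = p x"
    using S(1) unfolding ultrahomogeneous_def by (metis finite_imageI)
  show thesis
  proof
    show "is_embedding n (g \<circ> k) (induced A ?S) U"
      using is_embedding_comp[OF k is_iso_imp_embedding[OF g(1)]] .
    show "(g \<circ> k) x = f x" if "x \<in> S" for x
      using that g(2) pk by simp
  qed
qed

text \<open>This is the forth half of a back-and-forth argument: finite partial embeddings are
  extended one element at a time and glued together.\<close>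

lemma fraisse_limit_universal:
  fixes A :: "'b binstruct" and U :: "'a binstruct"
  assumes mn: "m \<le> n" and U: "is_fraisse_limit n (finite_simple n m) U"
    and A: "simple_binary n m A" "countable (univ A)"
  shows "embeds n A U"
proof -
  define F where "F k = {x \<in> univ A. to_nat_on (univ A) x < k}" for k
  have inj: "inj_on (to_nat_on (univ A)) (univ A)"
    using A(2) by (rule inj_on_to_nat_on)
  have F0: "F 0 = {}" and FA: "\<And>k. F k \<subseteq> univ A"
    by (auto simp: F_def)
  have finF: "finite (F k)" for k
  proof (rule inj_on_finite)
    show "inj_on (to_nat_on (univ A)) (F k)"
      using inj FA by (rule inj_on_subset)
    show "to_nat_on (univ A) ` F k \<subseteq> {..<k}"
      by (auto simp: F_def)
  qed simp
  \<comment> \<open>A number \<open>k\<close> that belongs to no element leaves the stage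
    unchanged.\<close>
  have FSuc: "F (Suc k) = F k \<or> (\<exists>a\<in>univ A. F (Suc k) = insert a (F k))" for k
  proof (cases "k \<in> to_nat_on (univ A) ` univ A")
    case True
    then obtain a where "a \<in> univ A" "k = to_nat_on (univ A) a"
      by blast
    then have "F (Suc k) = insert a (F k)"
      using inj by (auto simp: F_def less_Suc_eq inj_on_eq_iff)
    then show ?thesis
      using \<open>a \<in> univ A\<close> by blast
  next
    case False
    then have "F (Suc k) = F k"
      by (auto simp: F_def less_Suc_eq)
    then show ?thesis ..
  qed
  \<comment> \<open>Extensions are not canonical, so each map is chosen depending on the previous
    one.\<close>
  have "\<exists>\<phi>. \<forall>k. is_embedding n (\<phi> k) (induced A (F k)) U \<and>
      (\<forall>x\<in>F k. \<phi> (Suc k) x = \<phi> k x)"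
  proof (rule dependent_nat_choice)
    show "\<exists>f. is_embedding n f (induced A (F 0)) U"
      by (simp add: F0 is_embedding_def)
    fix f k assume f: "is_embedding n f (induced A (F k)) U"
    show "\<exists>g. is_embedding n g (induced A (F (Suc k))) U \<and> (\<forall>x\<in>F k. g x = f x)"
    proof (cases "F (Suc k) = F k")
      case False
      then obtain a where a: "a \<in> univ A" "F (Suc k) = insert a (F k)"
        using FSuc by blast
      obtain g where "is_embedding n g (induced A (insert a (F k))) U" "\<And>x. x \<in> F k \<Longrightarrow> g x = f x"
        by (rule fraisse_limit_extension[OF mn U A(1) finF[of k] _ f, of a]) (use a FA in auto)
      then show ?thesis
        using a by auto
    qed (use f in auto)
  qed
  then obtain \<phi> where \<phi>: "\<And>k. is_embedding n (\<phi> k) (induced A (F k)) U"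
      "\<And>k x. x \<in> F k \<Longrightarrow> \<phi> (Suc k) x = \<phi> k x"
    by blast
  have stable: "\<phi> l x = \<phi> k x" if "k \<le> l" "x \<in> F k" for k l x
    using that(1)
  proof (induction l rule: dec_induct)
    case (step l)
    then have "x \<in> F l"
      using that(2) by (auto simp: F_def)
    then show ?case
      using step \<phi>(2) by simp
  qed simp
  \<comment> \<open>The first stage containing \<open>x\<close> has index one above the number of
    \<open>x\<close>, because \<open>F\<close> uses a strict bound.\<close>
  define f where "f x = \<phi> (Suc (to_nat_on (univ A) x)) x" for x
  have f: "f x = \<phi> k x" if "x \<in> F k" for x k
    unfolding f_def using that by (intro stable[symmetric]) (auto simp: F_def)
  \<comment> \<open>Injectivity and preservation involve two elements, so a common stage reduces
    them to a single \<open>\<phi> k\<close>.\<close>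
  have pair: "\<exists>k. x \<in> F k \<and> y \<in> F k" if "x \<in> univ A" "y \<in> univ A" for x y
    using that
    by (intro exI[of _ "Suc (max (to_nat_on (univ A) x) (to_nat_on (univ A) y))"])
      (auto simp: F_def)
  have *: "f x \<in> univ U \<and> (f x = f y \<longrightarrow> x = y) \<and>
      (\<forall>i<n. rel A i x y \<longleftrightarrow> rel U i (f x) (f y))"
    if xy: "x \<in> univ A" "y \<in> univ A" for x y
  proof -
    obtain k where k: "x \<in> F k" "y \<in> F k"
      using pair[OF xy] by blast
    then show ?thesis
      using \<phi>(1)[of k] by (auto simp: f is_embedding_def inj_on_eq_iff)
  qed
  have "is_embedding n f A U"
    unfolding is_embedding_def inj_on_def using * by blast
  then show ?thesis
    unfolding embeds_iff_embedding by blast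
qed

section \<open>The tree structure\<close>

text \<open>
  An entry \<open>p\<close> of the longer of two sequences codes which relations lead from the shorter one to
  the longer one (\<open>code_fwd\<close>) and back (\<open>code_bwd\<close>).
\<close>

definition code_fwd :: "nat \<Rightarrow> nat \<Rightarrow> nat \<Rightarrow> bool" where
  "code_fwd m p i \<longleftrightarrow> p < m \<and> i = p \<or> m \<le> p \<and> even (p - m) \<and> i = m + (p - m) div 2"

definition code_bwd :: "nat \<Rightarrow> nat \<Rightarrow> nat \<Rightarrow> bool" where
  "code_bwd m p i \<longleftrightarrow> p < m \<and> i = p \<or> m \<le> p \<and> odd (p - m) \<and> i = m + (p - m - 1) div 2"

lemma tree_rel_shorter:
  assumes "length x < length y"
  shows "tree_rel m i x y \<longleftrightarrow> code_fwd m (y ! length x) i"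
    and "tree_rel m i y x \<longleftrightarrow> code_bwd m (y ! length x) i"
  using assms by (auto simp: code_fwd_def code_bwd_def tree_rel.simps)

lemma tree_rel_level:
  assumes "length x = length y"
  shows "tree_rel m i x y \<longleftrightarrow> i = 0 \<and> (x \<lhd> y \<or> 0 < m \<and> y \<lhd> x)"
  using assms by (auto simp: tree_rel.simps)

lemma longest_common_prefix_commute: "longest_common_prefix x y = longest_common_prefix y x"
  by (induction x y rule: longest_common_prefix.induct) auto

lemma seq_prec_asym: "x \<lhd> y \<Longrightarrow> \<not> y \<lhd> x"
  by (simp add: seq_prec_def longest_common_prefix_commute[of y x])

text \<open>Distinct sequences of equal length are incomparable, and their entries at the length of
  the meet differ.\<close>

lemma seq_prec_total:
  assumes "length x = length y" "x \<noteq> y"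
  shows "x \<lhd> y \<or> y \<lhd> x"
proof -
  have par: "x \<parallel> y"
    using assms by (metis not_equal_is_parallel)
  let ?k = "length (meet x y)"
  have "x ! ?k \<noteq> y ! ?k"
    using assms by (induction x y rule: list_induct2) auto
  then show ?thesis
    using par by (auto simp: seq_prec_def longest_common_prefix_commute[of y x] parallel_commute)
qed

text \<open>Exactly one index \<open>j\<close> relates the pair. A symmetric \<open>j\<close> is
  coded by itself; an asymmetric \<open>m + q\<close> needs two entries, \<open>m + 2 * q\<close>
  and \<open>m + 2 * q + 1\<close>, one per direction, which explains the value of
  \<open>branching\<close>.\<close>

lemma code_pair:
  assumes "m \<le> n" "simple_binary n m A" "x \<in> univ A" "y \<in> univ A" "x \<noteq> y"
  obtains p where "p < branching n m"
    and "\<And>i. i < n \<Longrightarrow> rel A i x y \<longleftrightarrow> code_fwd m p i"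
    and "\<And>i. i < n \<Longrightarrow> rel A i y x \<longleftrightarrow> code_bwd m p i"
proof -
  have xy: "simple_pair n m (rel A) x y" and yx: "simple_pair n m (rel A) y x"
    using assms by (auto simp: simple_binary_iff_pairs)
  obtain j where j: "j < n" "rel A j x y \<or> rel A j y x"
    using xy assms(5) by (auto simp: simple_pair_def)
  \<comment> \<open>Exclusivity starts from an instance in the order of the pair, so the two
    possible directions of \<open>j\<close> call for \<open>xy\<close> and \<open>yx\<close>
    respectively.\<close>
  have other: "\<not> rel A i x y \<and> \<not> rel A i y x" if "i < n" "i \<noteq> j" for i
  proof -
    have "rel A j x y \<Longrightarrow> ?thesis"
      using xy that j(1) assms(5) by (simp add: simple_pair_def)
    moreover have "rel A j y x \<Longrightarrow> ?thesis"
      using yx that j(1) assms(5) by (simp add: simple_pair_def)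
    ultimately show ?thesis
      using j(2) by blast
  qed
  show thesis
  proof (cases "j < m")
    case True
    then have "rel A j x y" "rel A j y x"
      using j xy yx by (auto simp: simple_pair_def)
    then show thesis
      using True other assms(1)
      by (intro that[of j]) (auto simp: branching_def code_fwd_def code_bwd_def)
  next
    case False
    then obtain q where q: "j = m + q"
      using le_Suc_ex not_less by blast
    have asym: "\<not> (rel A j x y \<and> rel A j y x)"
      using j xy q by (simp add: simple_pair_def)
    show thesis
    proof (cases "rel A j x y")
      case True
      then show thesis
        using q j asym other
        by (intro that[of "m + 2 * q"]) (auto simp: branching_def code_fwd_def code_bwd_def)
    next
      case False
      then show thesis
        using q j other
        by (intro that[of "m + 2 * q + 1"]) (auto simp: branching_def code_fwd_def code_bwd_def)
    qed
  qed
qed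

text \<open>These facts are the clauses of \<open>simple_pair\<close> for distinct elements, read
  off a single entry.\<close>

lemma code_simple:
  assumes "m \<le> n" "p < branching n m"
  shows "\<exists>i<n. code_fwd m p i \<or> code_bwd m p i"
    and "code_fwd m p i \<Longrightarrow> code_fwd m p j \<Longrightarrow> i = j"
    and "code_bwd m p i \<Longrightarrow> code_bwd m p j \<Longrightarrow> i = j"
    and "code_fwd m p i \<Longrightarrow> code_bwd m p j \<Longrightarrow> i = j"
    and "i < m \<Longrightarrow> code_fwd m p i \<longleftrightarrow> code_bwd m p i"
    and "m \<le> i \<Longrightarrow> code_fwd m p i \<Longrightarrow> \<not> code_bwd m p i"
proof -
  consider "p < m" | q where "p = m + 2 * q" | q where "p = m + 2 * q + 1"
    by (metis add.assoc le_Suc_ex not_le oddE evenE)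
  then show "\<exists>i<n. code_fwd m p i \<or> code_bwd m p i"
  proof cases
    case 1
    with assms show ?thesis
      by (intro exI[of _ p]) (auto simp: code_fwd_def)
  next
    case (2 q)
    with assms show ?thesis
      by (intro exI[of _ "m + q"]) (auto simp: code_fwd_def branching_def)
  next
    case (3 q)
    with assms show ?thesis
      by (intro exI[of _ "m + q"]) (auto simp: code_bwd_def branching_def)
  qed
qed (auto simp: code_fwd_def code_bwd_def)

lemma T_struct_simple:
  assumes "m \<le> n" "2 \<le> branching n m"
  shows "simple_binary n m (T_struct n m)"
proof -
  \<comment> \<open>Sequences of equal length are related by index 0 only, so 0 must be a legal
    index.\<close>
  have n: "0 < n"
    using assms by (auto simp: branching_def)
  have irrefl: "\<not> tree_rel m i x x" for i x
    by (simp add: tree_rel_level seq_prec_def)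
  \<comment> \<open>\<open>simple_pair\<close> is not symmetric in its arguments; proving both
    orders at once permits assuming that \<open>x\<close> is not longer than
    \<open>y\<close>.\<close>
  have pair: "simple_pair n m (tree_rel m) x y \<and> simple_pair n m (tree_rel m) y x"
    if xy: "x \<in> lists {..<branching n m}" "y \<in> lists {..<branching n m}"
      "length x \<le> length y" for x y
  proof (cases "length x < length y")
    case True
    then have "y ! length x < branching n m"
      using xy(2) by (auto simp: in_lists_conv_set)
    note c = code_simple[OF assms(1) this]
    show ?thesis
      unfolding simple_pair_def tree_rel_shorter[OF True] using irrefl c
      by (intro conjI; blast)
  next
    case False
    then have eq: "length x = length y"
      using xy by simp
    show ?thesis
    proof (cases "x = y")
      case True
      then show ?thesis
        by (simp add: simple_pair_def irrefl)
    next
      case False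
      then show ?thesis
        using n seq_prec_total[OF eq] seq_prec_asym[of x y] irrefl
        by (auto simp: simple_pair_def tree_rel_level eq)
    qed
  qed
  show ?thesis
    unfolding simple_binary_iff_pairs T_struct_def
    using pair by (simp, meson nat_le_linear)
qed

section \<open>Embedding the limit into the diagonal structure\<close>

text \<open>The length of an image is the number of the element, so injectivity of the numbering
  yields both injectivity of \<open>f\<close> and the distinct lengths needed for
  \<open>\<Delta>\<close>.\<close>

lemma simple_embeds_distinct_lengths:
  fixes A :: "'a binstruct"
  assumes mn: "m \<le> n" and d: "2 \<le> branching n m"
    and A: "simple_binary n m A" "countable (univ A)"
  obtains f where "is_embedding n f A (T_struct n m)" "inj_on (length \<circ> f) (univ A)"
proof -
  define e where "e = to_nat_on (univ A)"
  have inj: "inj_on e (univ A)"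
    unfolding e_def using A(2) by (rule inj_on_to_nat_on)
  have "\<forall>x\<in>univ A. \<forall>y\<in>univ A. x \<noteq> y \<longrightarrow> (\<exists>p<branching n m. \<forall>i<n.
      (rel A i x y \<longleftrightarrow> code_fwd m p i) \<and> (rel A i y x \<longleftrightarrow> code_bwd m p i))"
    by (metis code_pair[OF mn A(1)])
  then obtain c where c: "\<And>x y. x \<in> univ A \<Longrightarrow> y \<in> univ A \<Longrightarrow> x \<noteq> y \<Longrightarrow>
      c x y < branching n m \<and> (\<forall>i<n.
      (rel A i x y \<longleftrightarrow> code_fwd m (c x y) i) \<and> (rel A i y x \<longleftrightarrow> code_bwd m (c x y) i))"
    by metis
  \<comment> \<open>Positions that number no element get 0, a legal entry by \<open>d\<close>; no
    relation between images reads them.\<close>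
  define entry where
    "entry y j = (if j \<in> e ` univ A then c (inv_into (univ A) e j) y else 0)" for y j
  define f where "f y = map (entry y) [0..<e y]" for y
  have len: "length (f y) = e y" for y
    by (simp add: f_def)
  have T: "f y \<in> univ (T_struct n m)" if y: "y \<in> univ A" for y
  proof -
    have "entry y j < branching n m" if "j < e y" for j
    proof (cases "j \<in> e ` univ A")
      case True
      then obtain x where "x \<in> univ A" "j = e x"
        by blast
      then show ?thesis
        using that y c[of x y] inj by (auto simp: entry_def)
    qed (use d in \<open>simp add: entry_def\<close>)
    then show ?thesis
      by (auto simp: f_def T_struct_def)
  qed
  have shorter: "rel A i x y = tree_rel m i (f x) (f y) \<and> rel A i y x = tree_rel m i (f y) (f x)"
    if "x \<in> univ A" "y \<in> univ A" "e x < e y" "i < n" for x y i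
  proof -
    have "f y ! length (f x) = c x y"
      using that inj by (simp add: len) (simp add: f_def entry_def)
    then show ?thesis
      using that c[of x y] tree_rel_shorter[of "f x" "f y" m i] by (auto simp: len)
  qed
  have injl: "inj_on (length \<circ> f) (univ A)"
    using inj by (simp add: inj_on_def len)
  have "rel A i x y \<longleftrightarrow> tree_rel m i (f x) (f y)"
    if xy: "x \<in> univ A" "y \<in> univ A" and i: "i < n" for i x y
  proof (cases "x = y")
    case True
    then show ?thesis
      using A(1) xy i by (simp add: simple_binary_def tree_rel_level seq_prec_def)
  next
    case False
    then have "e x < e y \<or> e y < e x"
      using inj xy by (metis inj_on_eq_iff nat_neq_iff)
    then show ?thesis
      using shorter xy i by blast
  qed
  moreover have "f ` univ A \<subseteq> univ (T_struct n m)"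
    using T by blast
  moreover have "inj_on f (univ A)"
    using injl by (rule inj_on_imageI2)
  ultimately have "is_embedding n f A (T_struct n m)"
    by (simp add: is_embedding_def T_struct_def)
  then show thesis
    using injl that by blast
qed

lemma longest_common_prefix_self: "longest_common_prefix x x = x"
  by (induction x) auto

text \<open>For different lengths the relation depends only on which sequence is shorter and on one
  entry of the longer, and \<open>\<Delta>\<close> preserves both.\<close>

lemma strong_diagonalization_tree_rel:
  assumes \<Delta>: "strong_diagonalization d \<Delta>"
    and xy: "x \<in> lists {..<d}" "y \<in> lists {..<d}" "length x \<noteq> length y"
  shows "tree_rel m i (\<Delta> x) (\<Delta> y) \<longleftrightarrow> tree_rel m i x y"
proof -
  \<comment> \<open>Since \<open>meet u u = u\<close>, the condition on lengths of meets specializes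
    to strict monotonicity of lengths.\<close>
  have *: "length (\<Delta> u) < length (\<Delta> v) \<and> v ! length u = \<Delta> v ! length (\<Delta> u)"
    if "u \<in> lists {..<d}" "v \<in> lists {..<d}" "length u < length v" for u v
    using \<Delta> that unfolding strong_diagonalization_def
    by (metis longest_common_prefix_self)
  show ?thesis
  proof (cases "length x < length y")
    case True
    then show ?thesis
      using *[OF xy(1,2)] by (simp add: tree_rel_shorter)
  next
    case False
    then have "length y < length x"
      using xy(3) by simp
    then show ?thesis
      using *[OF xy(2,1)] by (simp add: tree_rel_shorter)
  qed
qed

lemma simple_embeds_D_struct:
  assumes "m \<le> n" "2 \<le> branching n m" "simple_binary n m A" "countable (univ A)"
    and \<Delta>: "strong_diagonalization (branching n m) \<Delta>"
  shows "embeds n A (D_struct n m \<Delta>)"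
proof -
  obtain f where f: "is_embedding n f A (T_struct n m)" "inj_on (length \<circ> f) (univ A)"
    using simple_embeds_distinct_lengths[OF assms(1-4)] .
  let ?L = "lists {..<branching n m}"
  have fL: "f x \<in> ?L" if "x \<in> univ A" for x
    using f(1) that by (auto simp: is_embedding_def T_struct_def)
  have "inj_on \<Delta> (f ` univ A)"
    using \<Delta> fL by (auto simp: strong_diagonalization_def intro: inj_on_subset)
  then have inj: "inj_on (\<Delta> \<circ> f) (univ A)"
    using f(1) by (simp add: is_embedding_def comp_inj_on)
  have "rel A i x y \<longleftrightarrow> tree_rel m i (\<Delta> (f x)) (\<Delta> (f y))"
    if "x \<in> univ A" "y \<in> univ A" "i < n" for i x y
  \<comment> \<open>Preservation by \<open>\<Delta>\<close> requires different lengths, so equal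
    arguments are settled by irreflexivity on both sides.\<close>
  proof (cases "x = y")
    case True
    then show ?thesis
      using assms(3) that by (simp add: simple_binary_def tree_rel_level seq_prec_def)
  next
    case False
    then have "length (f x) \<noteq> length (f y)"
      using f(2) that by (auto simp: inj_on_def)
    then have "tree_rel m i (\<Delta> (f x)) (\<Delta> (f y)) \<longleftrightarrow> tree_rel m i (f x) (f y)"
      using strong_diagonalization_tree_rel[OF \<Delta>] fL that by blast
    then show ?thesis
      using f(1) that by (simp add: is_embedding_def T_struct_def)
  qed
  then have "is_embedding n (\<Delta> \<circ> f) A (D_struct n m \<Delta>)"
    using inj fL by (auto simp: is_embedding_def D_struct_def T_struct_def)
  then show ?thesis
    unfolding embeds_iff_embedding by blast
qed

theorem theorem3p1:
  fixes n m :: nat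
    and U :: "'a binstruct"
    and \<Delta> :: "nat list \<Rightarrow> nat list"
  assumes "m \<le> n"
    and "branching n m \<ge> 2"
    and "is_fraisse_limit n (finite_simple n m) U"
    and "strong_diagonalization (branching n m) \<Delta>"
  shows "equimorphic n U (T_struct n m) \<and>
         equimorphic n U (D_struct n m \<Delta>) \<and>
         equimorphic n (T_struct n m) (D_struct n m \<Delta>)"
proof -
  have UD: "embeds n U (D_struct n m \<Delta>)"
    using assms fraisse_limit_simple[OF assms(1,3)]
    by (intro simple_embeds_D_struct) (simp_all add: is_fraisse_limit_def)
  have "is_embedding n id (D_struct n m \<Delta>) (T_struct n m)"
    using assms(4)
    by (auto simp: is_embedding_def D_struct_def T_struct_def strong_diagonalization_def)
  then have DT: "embeds n (D_struct n m \<Delta>) (T_struct n m)"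
    unfolding embeds_iff_embedding by blast
  have TU: "embeds n (T_struct n m) U"
    using T_struct_simple[OF assms(1,2)]
    by (intro fraisse_limit_universal[OF assms(1,3)]) (simp_all add: T_struct_def)
  \<comment> \<open>The three embeddings form a cycle, so compositions give the remaining
    directions.\<close>
  show ?thesis
    unfolding equimorphic_def using UD DT TU embeds_trans by metis
qed

end
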